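(* Let $\mathcal{M}_i=\{f_{\boldsymbol\theta_i}:\boldsymbol\theta_i\in\mathcal{H}_i\}$ and $\mathcal{M}_j=\{f_{\boldsymbol\theta_j}:\boldsymbol\theta_j\in\mathcal{H}_j\}$ be two models whose classes of loss functions $\mathcal{L}_i=\{l(\cdot,\boldsymbol\theta_i):\boldsymbol\theta_i\in\mathcal{H}_i\}$ and $\mathcal{L}_j=\{l(\cdot,\boldsymbol\theta_j):\boldsymbol\theta_j\in\mathcal{H}_j\}$ are Glivenko–Cantelli classes for the distribution of $\mathbf{Z}$. Then there are a function $\gamma_{i,j}(n,\delta,S_n)$ of order $o(1)$ and a positive integer $N$ such that for every $n\ge N$ and every $0<\delta\le 1$, $$\mathbb{P}\Big\{\big|R_{emp}(S_n,\hat{\boldsymbol\theta}_i)-R_{emp}(S_n,\hat{\boldsymbol\theta}_j)-R(\boldsymbol\theta_i^* )+R(\boldsymbol\theta_j^* )\big|\le\gamma_{i,j}(n,\delta,S_n)\Big\}\ge 1-\delta .$$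
   Context: Setting: $S_n=(\mathbf{z}_1,\dots,\mathbf{z}_n)$ consists of $n$ i.i.d. copies of a random element $\mathbf{Z}$ with unknown distribution $\mathcal{P}$ (on $\mathcal{X}\subset\mathbb{R}^p$ with $\mathbf{z}=\mathbf{x}$ in the unsupervised case, or on $\mathcal{X}\times\mathcal{Y}$, $\mathcal{Y}\subset\mathbb{R}^q$, with $\mathbf{z}=(\mathbf{x},\mathbf{y})$ in the supervised case). A model $\mathcal{M}_k=\{f_{\boldsymbol\theta_k}:\boldsymbol\theta_k\in\mathcal{H}_k\}$ is a set of functions (probability densities or conditional densities / predictors) with parameter space $\mathcal{H}_k$. The nonnegative loss $l(\mathbf{z},\boldsymbol\theta)$ stands for $l(f_{\boldsymbol\theta}(\mathbf{x}))$ or $l(f_{\boldsymbol\theta}(\mathbf{x}),\mathbf{y})$, so it depends on $\boldsymbol\theta$ only through $f_{\boldsymbol\theta}$. The risk is $R(\boldsymbol\theta)=\mathbb{E}\{l(\mathbf{Z},\boldsymbol\theta)\}$ and the empirical risk is $R_{emp}(S_n,\boldsymbol\theta)=\frac1n\sum_{i=1}^n l(\mathbf{z}_i,\boldsymbol\theta)$. For each model, $\boldsymbol\theta_k^*\in\arg\min_{\boldsymbol\theta_k\in\mathcal{H}_k}R(\boldsymbol\theta_k)$ and $\hat{\boldsymbol\theta}_k\in\arg\min_{\boldsymbol\theta_k\in\mathcal{H}_k}R_{emp}(S_n,\boldsymbol\theta_k)$ (minimizers are assumed to exist). Glivenko–Cantelli: a class $\mathcal{F}$ is Glivenko–Cantelli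 for the distribution of $\mathbf{Z}$ if for every $\varepsilon>0$, $\lim_{n\to\infty}\mathbb{P}\{\sup_{f\in\mathcal{F}}|\frac1n\sum_{i=1}^n f(\mathbf{z}_i)-\mathbb{E}\{f(\mathbf{Z})\}|>\varepsilon\}=0$. Order $o(1)$: for every fixed $\delta\in(0,1]$ and every $\varepsilon>0$ there is $n_0$ such that $\gamma_{i,j}(n,\delta,S_n)\le\varepsilon$ for all $n\ge n_0$. Although $S_n$ appears as an argument in the notation, $\gamma_{i,j}$ is a deterministic function. *)

theory Defs
  imports "HOL-Probability.Probability"
begin

text \<open>
  An observation is an element of an arbitrary measurable space carrying the law
  \<open>P\<close> (borel sets of a subset of a Euclidean space, or of a product of two of them).
  A model is a family \<open>f\<close> of functions indexed by a parameter set \<open>H\<close>, and the loss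
  \<open>l (f \<theta>) z\<close> depends on \<open>\<theta>\<close> only through \<open>f \<theta>\<close>.  Losses \<open>l0 (f \<theta> x)\<close> at \<open>z = x\<close> are
  the instance \<open>l = (\<lambda>h x. l0 (h x))\<close>, and losses \<open>l0 (f \<theta> x) y\<close> at \<open>z = (x, y)\<close> the
  instance \<open>l = (\<lambda>h (x, y). l0 (h x) y)\<close>.
\<close>

definition loss_class ::
  "('f \<Rightarrow> 'z \<Rightarrow> real) \<Rightarrow> ('p \<Rightarrow> 'f) \<Rightarrow> 'p set \<Rightarrow> ('z \<Rightarrow> real) set" where
  "loss_class l f H = {(\<lambda>z. l (f \<theta>) z) | \<theta>. \<theta> \<in> H}"

definition risk ::
  "'z measure \<Rightarrow> ('f \<Rightarrow> 'z \<Rightarrow> real) \<Rightarrow> ('p \<Rightarrow> 'f) \<Rightarrow> 'p \<Rightarrow> real" where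
  "risk P l f \<theta> = (\<integral>z. l (f \<theta>) z \<partial>P)"

definition sample :: "(nat \<Rightarrow> 'w \<Rightarrow> 'z) \<Rightarrow> nat \<Rightarrow> 'w \<Rightarrow> nat \<Rightarrow> 'z" where
  "sample z n \<omega> = (\<lambda>i\<in>{1..n}. z i \<omega>)"

definition emp_mean :: "nat \<Rightarrow> (nat \<Rightarrow> 'z) \<Rightarrow> ('z \<Rightarrow> real) \<Rightarrow> real" where
  "emp_mean n S g = (1 / real n) * (\<Sum>i=1..n. g (S i))"

definition emp_risk ::
  "nat \<Rightarrow> (nat \<Rightarrow> 'z) \<Rightarrow> ('f \<Rightarrow> 'z \<Rightarrow> real) \<Rightarrow> ('p \<Rightarrow> 'f) \<Rightarrow> 'p \<Rightarrow> real" where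
  "emp_risk n S l f \<theta> = emp_mean n S (\<lambda>z. l (f \<theta>) z)"

text \<open>
  The supremum of an uncountable class need not be measurable, so its tail probability is
  an outer probability under the law of \<open>n\<close> i.i.d. observations; on measurable events this
  is the ordinary probability.  The supremum is taken in \<^typ>\<open>ennreal\<close> because it may be
  infinite.  The members of the class are integrable, so that their expectations make sense
  (\<^const>\<open>lebesgue_integral\<close> is 0 on non-integrable functions).
\<close>

definition glivenko_cantelli :: "'z measure \<Rightarrow> ('z \<Rightarrow> real) set \<Rightarrow> bool" where
  "glivenko_cantelli P F \<longleftrightarrow>
     (\<forall>g\<in>F. integrable P g) \<and>
     (\<forall>\<epsilon>>0.
       (\<lambda>n. outer_measure_of (PiM {1..n} (\<lambda>_. P))
              {S \<in> space (PiM {1..n} (\<lambda>_. P)).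
                 (SUP g\<in>F. ennreal \<bar>emp_mean n S g - (\<integral>z. g z \<partial>P)\<bar>) > ennreal \<epsilon>})
       \<longlonglongrightarrow> 0)"

text \<open>
  Empirical risk minimisers need not be measurable either; a lower bound on the inner
  probability of an event is a lower bound on its probability whenever it is measurable.
\<close>

definition inner_prob :: "'w measure \<Rightarrow> 'w set \<Rightarrow> real" where
  "inner_prob M A = (SUP B\<in>{B \<in> sets M. B \<subseteq> A}. measure M B)"

lemma inner_prob_eq_measure:
  assumes "prob_space M" "A \<in> sets M"
  shows "inner_prob M A = measure M A"
proof -
  interpret prob_space M by fact
  show ?thesis
    unfolding inner_prob_def
    by (rule cSup_eq_maximum) (use assms in \<open>auto intro: finite_measure_mono\<close>)
qed

text \<open>
  Order \<open>o(1)\<close> for a deterministic function of the sample size and the confidence level;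
  no rate uniform in \<open>\<delta>\<close> is demanded.
\<close>

definition order_o1 :: "(nat \<Rightarrow> real \<Rightarrow> real) \<Rightarrow> bool" where
  "order_o1 \<gamma> \<longleftrightarrow>
     (\<forall>\<delta>. 0 < \<delta> \<and> \<delta> \<le> 1 \<longrightarrow> (\<forall>\<epsilon>>0. \<exists>n0. \<forall>n\<ge>n0. \<gamma> n \<delta> \<le> \<epsilon>))"

end

theory Submission
  imports Defs
begin

text \<open>
  Off an event of small outer probability, every loss has empirical mean within \<open>\<epsilon>\<close> of its
  expectation, and then the minimum of the empirical risk is within \<open>\<epsilon>\<close> of the minimum of the
  risk; so the excess in the theorem tends to 0 in probability.  Since \<open>N\<close> must not depend
  on \<open>\<delta>\<close>, the excess must moreover be tight for each single \<open>n\<close>: by nonnegativity of the loss,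
  minimal empirical risks lie between 0 and the empirical risks at \<open>\<theta>\<^sup>*\<close>, which are random variables.
  Hence \<open>\<gamma> n \<delta>\<close> can be taken to be the \<open>(1 - \<delta>)\<close>-quantile of the excess plus \<open>1/n\<close>.
\<close>

context prob_space
begin

lemma inner_prob_bdd_above: "bdd_above ((\<lambda>B. prob B) ` {B \<in> events. B \<subseteq> A})"
  by (rule bdd_aboveI[of _ 1]) auto

text \<open>Lower bounds on inner probabilities are obtained below by exhibiting a measurable
  subset, so measurability of the event itself is never an issue.\<close>

lemma inner_prob_upper:
  assumes "B \<in> events" "B \<subseteq> A"
  shows "prob B \<le> inner_prob M A"
  unfolding inner_prob_def
  by (rule cSUP_upper[OF _ inner_prob_bdd_above]) (use assms in auto)

lemma inner_prob_mono:
  assumes "A \<subseteq> A'"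
  shows "inner_prob M A \<le> inner_prob M A'"
  unfolding inner_prob_def
  by (rule cSUP_subset_mono[OF _ inner_prob_bdd_above]) (use assms in auto)

text \<open>The events \<open>X \<le> k\<close> increase to the whole space because \<open>X\<close>
  is real-valued, so continuity from below brings their probability above \<open>1 - \<eta>\<close>
  for some \<open>k\<close>.\<close>

lemma random_variable_tight:
  fixes X :: "'a \<Rightarrow> real"
  assumes [measurable]: "random_variable borel X" and "\<eta> > 0"
  obtains c where "c \<ge> 0" "prob {\<omega> \<in> space M. X \<omega> \<le> c} \<ge> 1 - \<eta>"
proof -
  have "(\<lambda>k. prob {\<omega> \<in> space M. X \<omega> \<le> real k})
      \<longlonglongrightarrow> prob (\<Union>k. {\<omega> \<in> space M. X \<omega> \<le> real k})"
    by (rule finite_Lim_measure_incseq) (auto simp: incseq_def)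
  moreover have "(\<Union>k. {\<omega> \<in> space M. X \<omega> \<le> real k}) = space M"
    by (auto intro: real_arch_simple)
  ultimately have "(\<lambda>k. prob {\<omega> \<in> space M. X \<omega> \<le> real k}) \<longlonglongrightarrow> 1"
    by (simp add: prob_space)
  then have "\<forall>\<^sub>F k in sequentially. prob {\<omega> \<in> space M. X \<omega> \<le> real k} > 1 - \<eta>"
    by (rule order_tendstoD) (use \<open>\<eta> > 0\<close> in simp)
  then obtain k where "prob {\<omega> \<in> space M. X \<omega> \<le> real k} > 1 - \<eta>"
    by (auto simp: eventually_sequentially)
  with that[of "real k"] show thesis by simp
qed

text \<open>The two assumptions do separate jobs: \<open>tight\<close> makes the quantile finite for
  every \<open>n \<ge> 1\<close> whatever \<open>\<delta>\<close> is, and \<open>conv\<close> makes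
  it vanish as \<open>n\<close> grows with \<open>\<delta>\<close> fixed.\<close>

lemma inner_prob_quantile:
  fixes X :: "nat \<Rightarrow> 'a \<Rightarrow> real"
  defines "Q \<equiv> \<lambda>n c. inner_prob M {\<omega> \<in> space M. X n \<omega> \<le> c}"
  assumes tight: "\<And>n \<delta>. n \<ge> 1 \<Longrightarrow> 0 < \<delta> \<Longrightarrow> \<exists>c\<ge>0. Q n c \<ge> 1 - \<delta>"
    and conv: "\<And>\<epsilon> \<delta>. 0 < \<epsilon> \<Longrightarrow> 0 < \<delta> \<Longrightarrow> \<forall>\<^sub>F n in sequentially. Q n \<epsilon> \<ge> 1 - \<delta>"
  shows "\<exists>\<gamma>. order_o1 \<gamma> \<and> (\<forall>n\<ge>1. \<forall>\<delta>. 0 < \<delta> \<and> \<delta> \<le> 1 \<longrightarrow> Q n (\<gamma> n \<delta>) \<ge> 1 - \<delta>)"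
proof -
  \<comment> \<open>The constraint \<open>0 \<le> c\<close> bounds the set below, so that its real
    infimum is meaningful; for \<open>\<delta> = 1\<close> the other condition holds for every
    \<open>c\<close>.\<close>
  define C where "C n \<delta> = {c. 0 \<le> c \<and> Q n c \<ge> 1 - \<delta>}" for n \<delta>
  \<comment> \<open>The positive, vanishing slack \<open>1 / n\<close> puts some element of
    \<open>C n \<delta>\<close> below \<open>\<gamma> n \<delta>\<close>, which avoids proving that
    the infimum is attained.\<close>
  define \<gamma> where "\<gamma> n \<delta> = Inf (C n \<delta>) + 1 / real n" for n \<delta>
  have Q_mono: "Q n c \<le> Q n d" if "c \<le> d" for n c d
    unfolding Q_def by (rule inner_prob_mono) (use that in auto)
  have bdd: "bdd_below (C n \<delta>)" for n \<delta>
    by (rule bdd_belowI[of _ 0]) (auto simp: C_def)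
  have "Q n (\<gamma> n \<delta>) \<ge> 1 - \<delta>" if "n \<ge> 1" "0 < \<delta>" for n \<delta>
  proof -
    have "C n \<delta> \<noteq> {}" using tight[OF that] by (auto simp: C_def)
    moreover have "Inf (C n \<delta>) < \<gamma> n \<delta>" using that by (simp add: \<gamma>_def)
    ultimately obtain c where "c \<in> C n \<delta>" "c < \<gamma> n \<delta>"
      by (meson cInf_lessD)
    with Q_mono[of c "\<gamma> n \<delta>" n] show ?thesis by (auto simp: C_def)
  qed
  moreover have "\<exists>n0. \<forall>n\<ge>n0. \<gamma> n \<delta> \<le> \<epsilon>" if "0 < \<delta>" "0 < \<epsilon>" for \<delta> \<epsilon>
  proof -
    \<comment> \<open>Half of \<open>\<epsilon>\<close> is reserved for the slack and half for the
      infimum.\<close>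
    have "\<forall>\<^sub>F n in sequentially. 1 / real n < \<epsilon> / 2"
      by (rule order_tendstoD[OF lim_1_over_n]) (use that in simp)
    moreover have "\<forall>\<^sub>F n in sequentially. Q n (\<epsilon> / 2) \<ge> 1 - \<delta>"
      by (rule conv) (use that in auto)
    ultimately have "\<forall>\<^sub>F n in sequentially. \<gamma> n \<delta> \<le> \<epsilon>"
    proof eventually_elim
      case (elim n)
      then have "\<epsilon> / 2 \<in> C n \<delta>" using that by (auto simp: C_def)
      then have "Inf (C n \<delta>) \<le> \<epsilon> / 2" by (rule cInf_lower[OF _ bdd])
      with elim show ?case by (simp add: \<gamma>_def)
    qed
    then show ?thesis by (simp add: eventually_sequentially)
  qed
  ultimately show ?thesis
    by (intro exI[of _ \<gamma>]) (simp add: order_o1_def)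
qed

text \<open>By independence the joint law is the product of the marginal laws, each of which is
  \<open>P\<close>. This transfers bounds under the product measure to \<open>M\<close>;
  \<open>n \<ge> 1\<close> makes the index set nonempty.\<close>

lemma
  assumes "indep_vars (\<lambda>_. P) z {1..}" "\<And>k. k \<ge> 1 \<Longrightarrow> distr M P (z k) = P" "n \<ge> 1"
  shows measurable_sample: "sample z n \<in> M \<rightarrow>\<^sub>M PiM {1..n} (\<lambda>_. P)"
    and distr_sample: "distr M (PiM {1..n} (\<lambda>_. P)) (sample z n) = PiM {1..n} (\<lambda>_. P)"
proof -
  have rv: "random_variable P (z i)" if "i \<in> {1..n}" for i
    using assms(1) that by (auto simp: indep_vars_def)
  have sample_eq: "sample z n = (\<lambda>\<omega>. \<lambda>i\<in>{1..n}. z i \<omega>)"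
    by (auto simp: sample_def)
  show "sample z n \<in> M \<rightarrow>\<^sub>M PiM {1..n} (\<lambda>_. P)"
    unfolding sample_eq by (rule measurable_restrict) (rule rv)
  have "indep_vars (\<lambda>_. P) z {1..n}"
    by (rule indep_vars_subset[OF assms(1)]) auto
  then have "distr M (PiM {1..n} (\<lambda>_. P)) (sample z n) = PiM {1..n} (\<lambda>i. distr M P (z i))"
    using indep_vars_iff_distr_eq_PiM'[of "{1..n}" z "\<lambda>_. P"] rv \<open>n \<ge> 1\<close>
    by (simp add: sample_eq)
  also have "\<dots> = PiM {1..n} (\<lambda>_. P)"
    by (rule PiM_cong) (use assms(2) in auto)
  finally show "distr M (PiM {1..n} (\<lambda>_. P)) (sample z n) = PiM {1..n} (\<lambda>_. P)" .
qed

text \<open>The set of bad samples may be nonmeasurable, so it is enclosed in a measurable set of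
  small product measure, whose preimage under the sample map is the event \<open>B\<close>.\<close>

lemma glivenko_cantelli_sample:
  assumes iid: "indep_vars (\<lambda>_. P) z {1..}" "\<And>k. k \<ge> 1 \<Longrightarrow> distr M P (z k) = P"
    and gc: "glivenko_cantelli P F" and "\<epsilon> > 0" "\<eta> > 0"
  shows "\<forall>\<^sub>F n in sequentially. \<exists>B\<in>events. prob B \<le> \<eta> \<and>
    (\<forall>\<omega>\<in>space M - B. \<forall>g\<in>F. \<bar>emp_mean n (sample z n \<omega>) g - (\<integral>x. g x \<partial>P)\<bar> \<le> \<epsilon>)"
proof -
  define E where "E n = {S \<in> space (PiM {1..n} (\<lambda>_. P)).
    (SUP g\<in>F. ennreal \<bar>emp_mean n S g - (\<integral>x. g x \<partial>P)\<bar>) > ennreal \<epsilon>}" for n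
  have "(\<lambda>n. outer_measure_of (PiM {1..n} (\<lambda>_. P)) (E n)) \<longlonglongrightarrow> 0"
    using gc \<open>\<epsilon> > 0\<close> by (simp add: glivenko_cantelli_def E_def)
  then have "\<forall>\<^sub>F n in sequentially. outer_measure_of (PiM {1..n} (\<lambda>_. P)) (E n) < ennreal \<eta>"
    by (rule order_tendstoD) (use \<open>\<eta> > 0\<close> in simp)
  with eventually_ge_at_top[of 1] show ?thesis
  proof eventually_elim
    case (elim n)
    let ?Pn = "PiM {1..n} (\<lambda>_. P)"
    \<comment> \<open>Outer measure is an infimum over measurable supersets, so the strict bound is
      passed on to one of them.\<close>
    from elim(2) obtain B where B: "B \<in> sets ?Pn" "E n \<subseteq> B" "emeasure ?Pn B < ennreal \<eta>"
      by (auto simp: outer_measure_of_def INF_less_iff)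
    note samp[measurable] = measurable_sample[OF iid elim(1)]
    let ?B = "sample z n -` B \<inter> space M"
    have "emeasure M ?B = emeasure (distr M ?Pn (sample z n)) B"
      by (rule emeasure_distr[symmetric]) (use samp B in auto)
    also have "\<dots> < ennreal \<eta>"
      using B(3) by (simp only: distr_sample[OF iid elim(1)])
    finally have "prob ?B \<le> \<eta>"
      using \<open>\<eta> > 0\<close> by (simp add: emeasure_eq_measure ennreal_less_iff)
    moreover have "?B \<in> events"
      using samp B(1) by (rule measurable_sets)
    moreover have "\<bar>emp_mean n (sample z n \<omega>) g - (\<integral>x. g x \<partial>P)\<bar> \<le> \<epsilon>"
      if "\<omega> \<in> space M - ?B" "g \<in> F" for \<omega> g
    proof -
      have "sample z n \<omega> \<notin> E n" "sample z n \<omega> \<in> space ?Pn"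
        using that B(2) measurable_space[OF samp] by auto
      then have "(SUP g\<in>F. ennreal \<bar>emp_mean n (sample z n \<omega>) g - (\<integral>x. g x \<partial>P)\<bar>) \<le> ennreal \<epsilon>"
        by (simp add: E_def not_less)
      then have "ennreal \<bar>emp_mean n (sample z n \<omega>) g - (\<integral>x. g x \<partial>P)\<bar> \<le> ennreal \<epsilon>"
        using that(2) by (simp add: SUP_le_iff)
      then show ?thesis using \<open>\<epsilon> > 0\<close> by simp
    qed
    ultimately show ?case by blast
  qed
qed

end

text \<open>Each minimum is compared with the value at the other minimiser: the empirical minimum is
  at most the empirical risk at \<open>\<theta>'\<close>, and the minimal risk is at most the risk
  at \<open>\<theta>''\<close>. Uniform closeness then bounds the difference on both sides.\<close>

lemma emp_risk_arg_min_close: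
  assumes "is_arg_min (risk P l f) (\<lambda>\<theta>. \<theta> \<in> H) \<theta>'"
    and "is_arg_min (emp_risk n S l f) (\<lambda>\<theta>. \<theta> \<in> H) \<theta>''"
    and "\<forall>g\<in>loss_class l f H. \<bar>emp_mean n S g - (\<integral>x. g x \<partial>P)\<bar> \<le> \<epsilon>"
  shows "\<bar>emp_risk n S l f \<theta>'' - risk P l f \<theta>'\<bar> \<le> \<epsilon>"
proof -
  have dev: "\<bar>emp_risk n S l f \<theta> - risk P l f \<theta>\<bar> \<le> \<epsilon>" if "\<theta> \<in> H" for \<theta>
    using assms(3) that unfolding loss_class_def emp_risk_def risk_def by blast
  have "\<theta>' \<in> H" "\<theta>'' \<in> H" "risk P l f \<theta>' \<le> risk P l f \<theta>''"
    "emp_risk n S l f \<theta>'' \<le> emp_risk n S l f \<theta>'"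
    using assms(1,2) by (auto simp: is_arg_min_def not_less)
  with dev[of \<theta>'] dev[of \<theta>''] show ?thesis by linarith
qed

lemma emp_risk_nonneg:
  assumes "\<And>x. x \<in> space P \<Longrightarrow> l (f \<theta>) x \<ge> 0" "\<And>i. i \<in> {1..n} \<Longrightarrow> S i \<in> space P"
  shows "emp_risk n S l f \<theta> \<ge> 0"
  unfolding emp_risk_def emp_mean_def
  by (intro mult_nonneg_nonneg sum_nonneg assms) auto

theorem theorem1:
  fixes M :: "'w measure" and P :: "'z measure" and z :: "nat \<Rightarrow> 'w \<Rightarrow> 'z"
    and l :: "('x \<Rightarrow> 'v) \<Rightarrow> 'z \<Rightarrow> real"
    and fi :: "'a \<Rightarrow> 'x \<Rightarrow> 'v" and Hi :: "'a set"
    and fj :: "'b \<Rightarrow> 'x \<Rightarrow> 'v" and Hj :: "'b set"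
    and \<theta>i_star :: 'a and \<theta>j_star :: 'b
    and \<theta>i_hat :: "nat \<Rightarrow> 'w \<Rightarrow> 'a" and \<theta>j_hat :: "nat \<Rightarrow> 'w \<Rightarrow> 'b"
  assumes "prob_space M"
    and "prob_space.indep_vars M (\<lambda>_. P) z {1..}"
    and "\<And>k. k \<ge> 1 \<Longrightarrow> distr M P (z k) = P"
    and "\<And>\<theta> x. \<theta> \<in> Hi \<Longrightarrow> x \<in> space P \<Longrightarrow> l (fi \<theta>) x \<ge> 0"
    and "\<And>\<theta> x. \<theta> \<in> Hj \<Longrightarrow> x \<in> space P \<Longrightarrow> l (fj \<theta>) x \<ge> 0"
    and "is_arg_min (risk P l fi) (\<lambda>\<theta>. \<theta> \<in> Hi) \<theta>i_star"
    and "is_arg_min (risk P l fj) (\<lambda>\<theta>. \<theta> \<in> Hj) \<theta>j_star"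
    and "\<And>n \<omega>. n \<ge> 1 \<Longrightarrow> \<omega> \<in> space M \<Longrightarrow>
           is_arg_min (emp_risk n (sample z n \<omega>) l fi) (\<lambda>\<theta>. \<theta> \<in> Hi) (\<theta>i_hat n \<omega>)"
    and "\<And>n \<omega>. n \<ge> 1 \<Longrightarrow> \<omega> \<in> space M \<Longrightarrow>
           is_arg_min (emp_risk n (sample z n \<omega>) l fj) (\<lambda>\<theta>. \<theta> \<in> Hj) (\<theta>j_hat n \<omega>)"
    and "glivenko_cantelli P (loss_class l fi Hi)"
    and "glivenko_cantelli P (loss_class l fj Hj)"
  shows "\<exists>(\<gamma> :: nat \<Rightarrow> real \<Rightarrow> real) (N :: nat). order_o1 \<gamma> \<and> N > 0 \<and>
           (\<forall>n\<ge>N. \<forall>\<delta>. 0 < \<delta> \<and> \<delta> \<le> 1 \<longrightarrow>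
             inner_prob M {\<omega> \<in> space M.
               \<bar>emp_risk n (sample z n \<omega>) l fi (\<theta>i_hat n \<omega>)
                 - emp_risk n (sample z n \<omega>) l fj (\<theta>j_hat n \<omega>)
                 - risk P l fi \<theta>i_star + risk P l fj \<theta>j_star\<bar> \<le> \<gamma> n \<delta>} \<ge> 1 - \<delta>)"
proof -
  interpret prob_space M by fact
  have gc: "\<forall>\<^sub>F n in sequentially. \<exists>B\<in>events. prob B \<le> \<eta> \<and>
    (\<forall>\<omega>\<in>space M - B. \<forall>g\<in>F. \<bar>emp_mean n (sample z n \<omega>) g - (\<integral>x. g x \<partial>P)\<bar> \<le> \<epsilon>)"
    if "glivenko_cantelli P F" "\<epsilon> > 0" "\<eta> > 0" for F \<epsilon> \<eta>
    using assms(2,3) that by (rule glivenko_cantelli_sample)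
  define X where "X n \<omega> = \<bar>emp_risk n (sample z n \<omega>) l fi (\<theta>i_hat n \<omega>)
    - emp_risk n (sample z n \<omega>) l fj (\<theta>j_hat n \<omega>) - risk P l fi \<theta>i_star + risk P l fj \<theta>j_star\<bar>"
    for n \<omega>
  have rv [measurable]: "random_variable P (z k)" if "k \<ge> 1" for k
    using assms(2) that by (auto simp: indep_vars_def)
  have in_H: "\<theta>i_star \<in> Hi" "\<theta>j_star \<in> Hj"
    using assms(6,7) by (auto simp: is_arg_min_def)
  \<comment> \<open>Membership in a Glivenko-Cantelli class includes integrability, which supplies
    measurability of the losses at the two fixed risk minimisers.\<close>
  have "integrable P (\<lambda>x. l (fi \<theta>i_star) x)" "integrable P (\<lambda>x. l (fj \<theta>j_star) x)"
    using assms(10,11) in_H unfolding glivenko_cantelli_def loss_class_def by blast+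
  then have [measurable]: "l (fi \<theta>i_star) \<in> borel_measurable P" "l (fj \<theta>j_star) \<in> borel_measurable P"
    by auto
  have tight: "\<exists>c\<ge>0. inner_prob M {\<omega> \<in> space M. X n \<omega> \<le> c} \<ge> 1 - \<delta>" if "n \<ge> 1" "\<delta> > 0" for n \<delta>
  proof -
    \<comment> \<open>\<open>W\<close> evaluates the empirical risks at fixed parameters only, hence
      is measurable even if \<open>X n\<close> is not, and it dominates \<open>X n\<close>.\<close>
    define W where "W \<omega> = emp_risk n (sample z n \<omega>) l fi \<theta>i_star + emp_risk n (sample z n \<omega>) l fj \<theta>j_star
      + \<bar>risk P l fi \<theta>i_star\<bar> + \<bar>risk P l fj \<theta>j_star\<bar>" for \<omega>
    have W: "random_variable borel W"
      unfolding W_def emp_risk_def emp_mean_def sample_def by simp measurable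
    obtain c where c: "c \<ge> 0" "prob {\<omega> \<in> space M. W \<omega> \<le> c} \<ge> 1 - \<delta>"
      using random_variable_tight[OF W \<open>\<delta> > 0\<close>] .
    have "X n \<omega> \<le> W \<omega>" if "\<omega> \<in> space M" for \<omega>
    proof -
      let ?S = "sample z n \<omega>"
      have S: "?S i \<in> space P" if "i \<in> {1..n}" for i
        using that \<open>\<omega> \<in> space M\<close> measurable_space[OF rv] by (auto simp: sample_def)
      have "\<theta>i_hat n \<omega> \<in> Hi" "emp_risk n ?S l fi (\<theta>i_hat n \<omega>) \<le> emp_risk n ?S l fi \<theta>i_star"
        "\<theta>j_hat n \<omega> \<in> Hj" "emp_risk n ?S l fj (\<theta>j_hat n \<omega>) \<le> emp_risk n ?S l fj \<theta>j_star"
        using assms(8,9)[OF \<open>n \<ge> 1\<close> that] in_H by (auto simp: is_arg_min_def not_less)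
      moreover from calculation have "emp_risk n ?S l fi (\<theta>i_hat n \<omega>) \<ge> 0"
        using assms(4) S by (intro emp_risk_nonneg[of P]) auto
      moreover from calculation have "emp_risk n ?S l fj (\<theta>j_hat n \<omega>) \<ge> 0"
        using assms(5) S by (intro emp_risk_nonneg[of P]) auto
      ultimately show ?thesis unfolding X_def W_def by linarith
    qed
    then have "prob {\<omega> \<in> space M. W \<omega> \<le> c} \<le> inner_prob M {\<omega> \<in> space M. X n \<omega> \<le> c}"
      by (intro inner_prob_upper) (use W in \<open>auto intro: order_trans\<close>)
    with c show ?thesis by (intro exI[of _ c]) simp
  qed
  have conv: "\<forall>\<^sub>F n in sequentially. inner_prob M {\<omega> \<in> space M. X n \<omega> \<le> \<epsilon>} \<ge> 1 - \<delta>"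
    if "\<epsilon> > 0" "\<delta> > 0" for \<epsilon> \<delta>
  proof -
    \<comment> \<open>One half of \<open>\<epsilon>\<close> goes to the deviation of each model, and
      one half of \<open>\<delta>\<close> to each exceptional event in the union bound.\<close>
    have half: "\<epsilon> / 2 > 0" "\<delta> / 2 > 0" using that by auto
    from eventually_ge_at_top[of 1] gc[OF assms(10) half] gc[OF assms(11) half]
    show ?thesis
    proof eventually_elim
      case (elim n)
      from elim(2) obtain A where A: "A \<in> events" "prob A \<le> \<delta> / 2"
        "\<And>\<omega>. \<omega> \<in> space M - A \<Longrightarrow> \<forall>g\<in>loss_class l fi Hi.
          \<bar>emp_mean n (sample z n \<omega>) g - (\<integral>x. g x \<partial>P)\<bar> \<le> \<epsilon> / 2" by blast
      from elim(3) obtain B where B: "B \<in> events" "prob B \<le> \<delta> / 2"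
        "\<And>\<omega>. \<omega> \<in> space M - B \<Longrightarrow> \<forall>g\<in>loss_class l fj Hj.
          \<bar>emp_mean n (sample z n \<omega>) g - (\<integral>x. g x \<partial>P)\<bar> \<le> \<epsilon> / 2" by blast
      have "X n \<omega> \<le> \<epsilon>" if \<omega>: "\<omega> \<in> space M - (A \<union> B)" for \<omega>
      proof -
        have "\<bar>emp_risk n (sample z n \<omega>) l fi (\<theta>i_hat n \<omega>) - risk P l fi \<theta>i_star\<bar> \<le> \<epsilon> / 2"
          by (rule emp_risk_arg_min_close[OF assms(6) assms(8) A(3)]) (use \<omega> elim(1) in auto)
        moreover have "\<bar>emp_risk n (sample z n \<omega>) l fj (\<theta>j_hat n \<omega>) - risk P l fj \<theta>j_star\<bar> \<le> \<epsilon> / 2"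
          by (rule emp_risk_arg_min_close[OF assms(7) assms(9) B(3)]) (use \<omega> elim(1) in auto)
        ultimately show ?thesis unfolding X_def by linarith
      qed
      \<comment> \<open>The complement of both exceptional events is the measurable subset
        witnessing the inner probability.\<close>
      then have "prob (space M - (A \<union> B)) \<le> inner_prob M {\<omega> \<in> space M. X n \<omega> \<le> \<epsilon>}"
        by (intro inner_prob_upper) (use A B in auto)
      moreover have "prob (A \<union> B) \<le> \<delta>"
        using measure_Un_le[OF A(1) B(1)] A(2) B(2) by linarith
      moreover have "prob (space M - (A \<union> B)) = 1 - prob (A \<union> B)"
        by (rule prob_compl) (use A B in auto)
      ultimately show ?case by linarith
    qed
  qed
  obtain \<gamma> where "order_o1 \<gamma>"
    "\<forall>n\<ge>1. \<forall>\<delta>. 0 < \<delta> \<and> \<delta> \<le> 1 \<longrightarrow> inner_prob M {\<omega> \<in> space M. X n \<omega> \<le> \<gamma> n \<delta>} \<ge> 1 - \<delta>"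
    using inner_prob_quantile[of X] tight conv by blast
  \<comment> \<open>The bound holds from the first sample size on, so \<open>N = 1\<close> serves
    all \<open>\<delta>\<close> at once.\<close>
  then show ?thesis
    unfolding X_def by (intro exI[of _ \<gamma>] exI[of _ "1::nat"]) simp
qed

end
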